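(* The following algorithm is an $(n-1)$-approximation algorithm for DNR, where $n=|V|$. On input a DNR instance $\mathcal{I}=(G=(V,E),d,r)$: (1) construct the Transshipment instance $\mathcal{I}'=(G,d,c)$ with $c(e)=\sqrt{r(e)}$ for each $e\in E$; (2) compute an optimal acyclic flow solution $f$ to $\mathcal{I}'$; (3) return $f$. That is, the algorithm runs in polynomial time and the returned acyclic flow $f$ satisfies $L(f)\le (n-1)\cdot\mathrm{OPT}(\mathcal{I})$.
   Context: Let $G=(V,E)$ be a connected undirected graph, $d\colon V\to\mathbb{R}$ a demand function with $\sum_{x\in V}d(x)=0$, and let $A=\{(x,y)\in V\times V : \{x,y\}\in E\}$. A flow satisfying $d$ is a function $f\colon A\to\mathbb{R}$ with $\sum_{x\in N_G(y)} f(x,y)=d(y)$ for all $y\in V$ and $f(x,y)=-f(y,x)$ for all $(x,y)\in A$. The flow $f$ is acyclic if its support, i.e. the undirected graph $(V,\{\{x,y\}\in E : f(x,y)\ne 0\})$, contains no (undirected) cycle. DNR: given $G$, $d$ and a resistance function $r\colon E\to\mathbb{R}_{\ge 0}$, find an acyclic flow $f$ satisfying $d$ that minimizes the power loss $L(f)=\sum_{\{x,y\}\in E} r(\{x,y\}) f(x,y)^2$. (Equivalently, find a spanning tree $T$ of $G$ minimizing the loss of the unique flow satisfying $d$ supported on $T$; the support of any acyclic flow extends to a spanning tree.) $\mathrm{OPT}(\mathcal{I})$ denotes the minimum loss for instance $\mathcal{I}$. Transshipment: given $G$, $d$ and a cost function $c\colon E\to\mathbb{R}_{\ge 0}$, find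 a flow $f$ satisfying $d$ that minimizes $\sum_{\{x,y\}\in E} c(\{x,y\})\,|f(x,y)|$. It is well known that every Transshipment instance has an optimal solution that is acyclic and that such a solution can be found in polynomial time. *)

theory Defs
  imports Complex_Main "HOL-Computational_Algebra.Polynomial"
begin

section \<open>Networks, flows, DNR and Transshipment\<close>

definition simple_graph :: "'a set \<Rightarrow> 'a set set \<Rightarrow> bool" where
  "simple_graph V E \<longleftrightarrow>
     finite V \<and> (\<forall>e\<in>E. \<exists>x\<in>V. \<exists>y\<in>V. x \<noteq> y \<and> e = {x, y})"

definition connected_graph :: "'a set \<Rightarrow> 'a set set \<Rightarrow> bool" where
  "connected_graph V E \<longleftrightarrow>
     V \<noteq> {} \<and> (\<forall>x\<in>V. \<forall>y\<in>V. (x, y) \<in> {(u, v). {u, v} \<in> E}\<^sup>*)"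

text \<open>The list holds the vertices of the cycle in order, without repeating the first one
  at the end.\<close>

definition graph_cycle :: "'a set set \<Rightarrow> 'a list \<Rightarrow> bool" where
  "graph_cycle E p \<longleftrightarrow>
     length p \<ge> 3 \<and> distinct p \<and>
     (\<forall>i<length p. {p ! i, p ! (Suc i mod length p)} \<in> E)"

definition arcs :: "'a set \<Rightarrow> 'a set set \<Rightarrow> ('a \<times> 'a) set" where
  "arcs V E = {(x, y) \<in> V \<times> V. {x, y} \<in> E}"

definition neighbours :: "'a set \<Rightarrow> 'a set set \<Rightarrow> 'a \<Rightarrow> 'a set" where
  "neighbours V E y = {x \<in> V. {x, y} \<in> E}"

text \<open>The data common to both problems: the weight \<open>w\<close> is the resistance function for DNR
  and the cost function for Transshipment.\<close>

definition network :: "'a set \<Rightarrow> 'a set set \<Rightarrow> ('a \<Rightarrow> real) \<Rightarrow> ('a set \<Rightarrow> real) \<Rightarrow> bool" where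
  "network V E d w \<longleftrightarrow>
     simple_graph V E \<and> connected_graph V E \<and> (\<Sum>x\<in>V. d x) = 0 \<and> (\<forall>e\<in>E. 0 \<le> w e)"

text \<open>Flows are functions on the arcs; values outside \<open>arcs V E\<close> are never inspected.\<close>

definition flow_satisfying ::
    "'a set \<Rightarrow> 'a set set \<Rightarrow> ('a \<Rightarrow> real) \<Rightarrow> ('a \<times> 'a \<Rightarrow> real) \<Rightarrow> bool" where
  "flow_satisfying V E d f \<longleftrightarrow>
     (\<forall>y\<in>V. (\<Sum>x\<in>neighbours V E y. f (x, y)) = d y) \<and>
     (\<forall>(x, y)\<in>arcs V E. f (x, y) = - f (y, x))"

definition support :: "'a set \<Rightarrow> 'a set set \<Rightarrow> ('a \<times> 'a \<Rightarrow> real) \<Rightarrow> 'a set set" where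
  "support V E f = {{x, y} | x y. (x, y) \<in> arcs V E \<and> f (x, y) \<noteq> 0}"

definition acyclic_flow ::
    "'a set \<Rightarrow> 'a set set \<Rightarrow> ('a \<Rightarrow> real) \<Rightarrow> ('a \<times> 'a \<Rightarrow> real) \<Rightarrow> bool" where
  "acyclic_flow V E d f \<longleftrightarrow>
     flow_satisfying V E d f \<and> (\<nexists>p. graph_cycle (support V E f) p)"

text \<open>An arbitrary orientation of an edge. It is only used in expressions that do not change
  when \<open>f (x, y)\<close> is replaced by \<open>- f (x, y)\<close>, so the choice is irrelevant for flows.\<close>

definition ends :: "'a set \<Rightarrow> 'a \<times> 'a" where
  "ends e = (SOME (x, y). e = {x, y})"

definition power_loss :: "'a set set \<Rightarrow> ('a set \<Rightarrow> real) \<Rightarrow> ('a \<times> 'a \<Rightarrow> real) \<Rightarrow> real" where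
  "power_loss E r f = (\<Sum>e\<in>E. r e * (f (ends e))\<^sup>2)"

definition transport_cost :: "'a set set \<Rightarrow> ('a set \<Rightarrow> real) \<Rightarrow> ('a \<times> 'a \<Rightarrow> real) \<Rightarrow> real" where
  "transport_cost E c f = (\<Sum>e\<in>E. c e * \<bar>f (ends e)\<bar>)"

text \<open>The set of losses is bounded below by 0 and, on a network, nonempty and finite,
  as a flow with acyclic support is determined by that support, so the infimum is a minimum.\<close>

definition OPT :: "'a set \<Rightarrow> 'a set set \<Rightarrow> ('a \<Rightarrow> real) \<Rightarrow> ('a set \<Rightarrow> real) \<Rightarrow> real" where
  "OPT V E d r = (INF f\<in>{f. acyclic_flow V E d f}. power_loss E r f)"

definition optimal_transshipment ::
    "'a set \<Rightarrow> 'a set set \<Rightarrow> ('a \<Rightarrow> real) \<Rightarrow> ('a set \<Rightarrow> real) \<Rightarrow> ('a \<times> 'a \<Rightarrow> real) \<Rightarrow> bool" where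
  "optimal_transshipment V E d c f \<longleftrightarrow>
     flow_satisfying V E d f \<and>
     (\<forall>g. flow_satisfying V E d g \<longrightarrow> transport_cost E c f \<le> transport_cost E c g)"


section \<open>Real RAM programs and their running time\<close>

text \<open>Demands, resistances and square roots of resistances are exact real numbers, so running
  time is measured on a real RAM: every arithmetic operation on reals (including square root),
  every comparison and every memory access takes one step.

  There are two separate stores, for naturals (counters, vertex names, addresses) and for
  reals, each with directly addressed registers and an indirectly addressed memory. To keep
  the unit-cost measure honest there is no multiplication on naturals (in \<open>t\<close> steps only
  numbers with \<open>O(t)\<close> additional bits can be produced), no rounding of reals to naturals, and
  the only real constants are naturals.\<close>

record state =
  nreg :: "nat \<Rightarrow> nat"
  nmem :: "nat \<Rightarrow> nat"
  rreg :: "nat \<Rightarrow> real"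
  rmem :: "nat \<Rightarrow> real"

datatype instr =
    NConst nat nat
  | NAdd nat nat nat
  | NSub nat nat nat
  | NLoad nat nat
  | NStore nat nat
  | RConst nat nat
  | RAdd nat nat nat
  | RSub nat nat nat
  | RMul nat nat nat
  | RDiv nat nat nat
  | RSqrt nat nat
  | RLoad nat nat
  | RStore nat nat

text \<open>The first argument is the target register, except for the two store instructions, where
  it is the natural register holding the target address.\<close>

fun step :: "instr \<Rightarrow> state \<Rightarrow> state" where
  "step (NConst a k) s = s\<lparr>nreg := (nreg s)(a := k)\<rparr>"
| "step (NAdd a b c) s = s\<lparr>nreg := (nreg s)(a := nreg s b + nreg s c)\<rparr>"
| "step (NSub a b c) s = s\<lparr>nreg := (nreg s)(a := nreg s b - nreg s c)\<rparr>"
| "step (NLoad a b) s = s\<lparr>nreg := (nreg s)(a := nmem s (nreg s b))\<rparr>"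
| "step (NStore a b) s = s\<lparr>nmem := (nmem s)(nreg s a := nreg s b)\<rparr>"
| "step (RConst a k) s = s\<lparr>rreg := (rreg s)(a := real k)\<rparr>"
| "step (RAdd a b c) s = s\<lparr>rreg := (rreg s)(a := rreg s b + rreg s c)\<rparr>"
| "step (RSub a b c) s = s\<lparr>rreg := (rreg s)(a := rreg s b - rreg s c)\<rparr>"
| "step (RMul a b c) s = s\<lparr>rreg := (rreg s)(a := rreg s b * rreg s c)\<rparr>"
| "step (RDiv a b c) s = s\<lparr>rreg := (rreg s)(a := rreg s b / rreg s c)\<rparr>"
| "step (RSqrt a b) s = s\<lparr>rreg := (rreg s)(a := sqrt (rreg s b))\<rparr>"
| "step (RLoad a b) s = s\<lparr>rreg := (rreg s)(a := rmem s (nreg s b))\<rparr>"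
| "step (RStore a b) s = s\<lparr>rmem := (rmem s)(nreg s a := rreg s b)\<rparr>"

datatype test = NLess nat nat | RLess nat nat

fun holds :: "test \<Rightarrow> state \<Rightarrow> bool" where
  "holds (NLess a b) s \<longleftrightarrow> nreg s a < nreg s b"
| "holds (RLess a b) s \<longleftrightarrow> rreg s a < rreg s b"

datatype prog =
    Do instr
  | Seq prog prog  (infixr ";;" 60)
  | Cond test prog prog
  | While test prog

text \<open>\<open>exec P s t s'\<close>: started in \<open>s\<close>, the program \<open>P\<close> halts in \<open>s'\<close> after exactly \<open>t\<close> steps.\<close>

inductive exec :: "prog \<Rightarrow> state \<Rightarrow> nat \<Rightarrow> state \<Rightarrow> bool" where
  Do: "exec (Do i) s 1 (step i s)"
| Seq: "exec P s t s' \<Longrightarrow> exec Q s' t' s'' \<Longrightarrow> exec (P ;; Q) s (t + t') s''"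
| CondTrue: "holds b s \<Longrightarrow> exec P s t s' \<Longrightarrow> exec (Cond b P Q) s (Suc t) s'"
| CondFalse: "\<not> holds b s \<Longrightarrow> exec Q s t s' \<Longrightarrow> exec (Cond b P Q) s (Suc t) s'"
| WhileFalse: "\<not> holds b s \<Longrightarrow> exec (While b P) s 1 s"
| WhileTrue: "holds b s \<Longrightarrow> exec P s t s' \<Longrightarrow> exec (While b P) s' t' s'' \<Longrightarrow>
    exec (While b P) s (Suc (t + t')) s''"


section \<open>Polynomial-time algorithms on networks\<close>

text \<open>Input networks have vertex set \<open>{..<n}\<close> and their edges are given as a list of pairs
  containing every edge exactly once, in either orientation.\<close>

definition edges_of :: "(nat \<times> nat) list \<Rightarrow> nat set set" where
  "edges_of es = (\<lambda>(x, y). {x, y}) ` set es"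

definition edge_listing :: "(nat \<times> nat) list \<Rightarrow> bool" where
  "edge_listing es \<longleftrightarrow> distinct (map (\<lambda>(x, y). {x, y}) es)"

text \<open>With \<open>m = length es\<close>: registers 0 and 1 hold \<open>n\<close> and \<open>m\<close>, the natural memory holds the
  edge list, and the real memory holds the \<open>n\<close> demands followed by the \<open>m\<close> edge weights.
  Everything else is 0.\<close>

definition encode ::
    "nat \<Rightarrow> (nat \<times> nat) list \<Rightarrow> (nat \<Rightarrow> real) \<Rightarrow> (nat set \<Rightarrow> real) \<Rightarrow> state" where
  "encode n es d w =
     \<lparr>nreg = (\<lambda>_. 0)(0 := n, 1 := length es),
      nmem = (\<lambda>i. if i < 2 * length es
                  then (if even i then fst (es ! (i div 2)) else snd (es ! (i div 2)))
                  else 0),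
      rreg = (\<lambda>_. 0),
      rmem = (\<lambda>i. if i < n then d i
                  else if i < n + length es
                  then w {fst (es ! (i - n)), snd (es ! (i - n))}
                  else 0)\<rparr>"

text \<open>On halting, the cell of the \<open>j\<close>-th edge weight holds the flow along the \<open>j\<close>-th listed
  pair; the flow in the opposite direction is its negative.\<close>

definition output_flow ::
    "nat \<Rightarrow> (nat \<times> nat) list \<Rightarrow> state \<Rightarrow> (nat \<times> nat \<Rightarrow> real) \<Rightarrow> bool" where
  "output_flow n es s f \<longleftrightarrow> (\<forall>j<length es. rmem s (n + j) = f (es ! j))"

text \<open>\<open>P\<close> halts on every network after a number of steps polynomial in \<open>n + m\<close> and outputs a
  flow related to the input by \<open>S\<close>.\<close>

definition poly_time_computes ::
    "prog \<Rightarrow>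
     (nat set \<Rightarrow> nat set set \<Rightarrow> (nat \<Rightarrow> real) \<Rightarrow> (nat set \<Rightarrow> real) \<Rightarrow> (nat \<times> nat \<Rightarrow> real) \<Rightarrow> bool)
     \<Rightarrow> bool" where
  "poly_time_computes P S \<longleftrightarrow>
     (\<exists>p :: nat poly. \<forall>n es d w.
        edge_listing es \<longrightarrow> network {..<n} (edges_of es) d w \<longrightarrow>
        (\<exists>t s f. exec P (encode n es d w) t s \<and> t \<le> poly p (n + length es) \<and>
                 output_flow n es s f \<and> S {..<n} (edges_of es) d w f))"

definition acyclic_transshipment_solver :: "prog \<Rightarrow> bool" where
  "acyclic_transshipment_solver P \<longleftrightarrow>
     poly_time_computes P
       (\<lambda>V E d c f. acyclic_flow V E d f \<and> optimal_transshipment V E d c f)"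

definition dnr_approximation_algorithm :: "(nat \<Rightarrow> real) \<Rightarrow> prog \<Rightarrow> bool" where
  "dnr_approximation_algorithm \<alpha> P \<longleftrightarrow>
     poly_time_computes P
       (\<lambda>V E d r f. acyclic_flow V E d f \<and> power_loss E r f \<le> \<alpha> (card V) * OPT V E d r)"

text \<open>Replaces the weight in every cell \<open>n, \<dots>, n + m - 1\<close> of the real memory by its square root,
  and finally clears the auxiliary registers so that the resulting state is again an encoding.\<close>

definition sqrt_weights :: prog where
  "sqrt_weights =
     Do (NConst 2 1) ;;
     Do (NConst 3 0) ;;
     Do (NAdd 3 0 3) ;;
     Do (NAdd 4 0 1) ;;
     While (NLess 3 4)
       (Do (RLoad 0 3) ;; Do (RSqrt 0 0) ;; Do (RStore 3 0) ;; Do (NAdd 3 3 2)) ;;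
     Do (NConst 2 0) ;;
     Do (NConst 3 0) ;;
     Do (NConst 4 0) ;;
     Do (RConst 0 0)"

definition dnr_algorithm :: "prog \<Rightarrow> prog" where
  "dnr_algorithm P = sqrt_weights ;; P"

end

theory Submission
  imports Defs "HOL-Analysis.Convex"
begin

text \<open>For a flow \<open>g\<close> let \<open>c(g)\<close> be its Transshipment cost for \<open>c = \<surd>r\<close>. Since a sum of squares of
  nonnegative numbers is at most the square of their sum, \<open>L(f) \<le> c(f)\<^sup>2\<close>. Conversely, if \<open>g\<close> is
  acyclic then its support is a forest, so \<open>c(g)\<close> has at most \<open>n - 1\<close> nonzero terms and
  Cauchy-Schwarz gives \<open>c(g)\<^sup>2 \<le> (n - 1) L(g)\<close>. Optimality \<open>c(f) \<le> c(g)\<close> links the two.\<close>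

section \<open>Edge bound for forests\<close>

lemma simple_graph_finite_edges:
  assumes "simple_graph V E"
  shows "finite E"
proof -
  have "E \<subseteq> Pow V" using assms by (auto simp: simple_graph_def)
  moreover have "finite V" using assms by (simp add: simple_graph_def)
  ultimately show ?thesis by (meson finite_Pow_iff finite_subset)
qed

text \<open>An end vertex of a longest path works: by maximality its neighbours lie on the path, and
  any neighbour beyond the second vertex would close a cycle. "At most one neighbour" also admits
  isolated vertices, since the graph may be disconnected.\<close>

lemma forest_has_leaf:
  assumes G: "simple_graph V E" and ne: "V \<noteq> {}" and ac: "\<nexists>p. graph_cycle E p"
  shows "\<exists>v\<in>V. \<forall>w w'. {v, w} \<in> E \<longrightarrow> {v, w'} \<in> E \<longrightarrow> w = w'"
proof -
  define path where "path p \<longleftrightarrow> p \<noteq> [] \<and> distinct p \<and> set p \<subseteq> V \<and>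
     (\<forall>i. Suc i < length p \<longrightarrow> {p ! i, p ! Suc i} \<in> E)" for p
  have fin: "finite V" and edge: "\<And>x y. {x, y} \<in> E \<Longrightarrow> x \<in> V \<and> y \<in> V \<and> x \<noteq> y"
    using G unfolding simple_graph_def by (auto simp: doubleton_eq_iff)
  obtain v0 where "v0 \<in> V" using ne by blast
  then have "path [v0]" by (simp add: path_def)
  \<comment> \<open>A distinct list in \<open>V\<close> has at most \<open>card V\<close> entries,
    so a longest path exists.\<close>
  moreover have "\<forall>p. path p \<longrightarrow> length p < Suc (card V)"
    using fin by (metis path_def card_mono distinct_card less_Suc_eq_le)
  ultimately obtain p where p: "path p" and longest: "\<And>q. path q \<Longrightarrow> length q \<le> length p"
    using Lattices_Big.ex_has_greatest_nat[of path "[v0]" length "Suc (card V)"] by blast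
  obtain v where v: "v = p ! 0" "v \<in> V" and len: "0 < length p"
    using p by (metis path_def length_greater_0_conv nth_mem subsetD)
  have "w = p ! 1" if vw: "{v, w} \<in> E" for w
  proof -
    have "w \<in> set p"
    proof (rule ccontr)
      assume "w \<notin> set p"
      then have "path (w # p)"
        using p edge[OF vw] vw v unfolding path_def
        by (auto simp: nth_Cons insert_commute split: nat.split)
      then show False using longest by fastforce
    qed
    then obtain i where i: "i < length p" "w = p ! i" by (metis in_set_conv_nth)
    have "i \<noteq> 0" using edge[OF vw] i v by metis
    moreover have "\<not> 2 \<le> i"
    proof
      assume "2 \<le> i"
      \<comment> \<open>The prefix up to position \<open>i\<close> is the cycle: index
        \<open>i\<close> wraps around to \<open>0\<close>, where the closing edge is
        \<open>{v, w}\<close>, and \<open>2 \<le> i\<close> gives the required three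
        vertices.\<close>
      moreover have "{p ! k, p ! (Suc k mod Suc i)} \<in> E" if "k < Suc i" for k
      proof (cases "k = i")
        case True
        then show ?thesis using vw i v by (simp add: insert_commute)
      next
        case False
        then show ?thesis using that p i by (simp add: path_def)
      qed
      ultimately have "graph_cycle E (take (Suc i) p)"
        using p i by (auto simp: graph_cycle_def path_def)
      then show False using ac by blast
    qed
    ultimately show ?thesis using i by (metis One_nat_def Suc_1 less_2_cases not_less)
  qed
  then show ?thesis using v by blast
qed

text \<open>Induction on the number of vertices: removing a vertex of degree at most one loses at
  most one edge and leaves a forest.\<close>

lemma forest_card_edges:
  assumes "simple_graph V E" "V \<noteq> {}" "\<nexists>p. graph_cycle E p"
  shows "card E < card V"
  using assms
proof (induction "card V" arbitrary: V E rule: less_induct)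
  case less
  have fin: "finite V" using less.prems by (simp add: simple_graph_def)
  have finE: "finite E" using less.prems simple_graph_finite_edges by blast
  obtain v where v: "v \<in> V" and leaf: "\<And>w w'. {v, w} \<in> E \<Longrightarrow> {v, w'} \<in> E \<Longrightarrow> w = w'"
    using forest_has_leaf[OF less.prems] by metis
  define F where "F = {e \<in> E. v \<notin> e}"
  have inc: "\<exists>w. e = {v, w}" if "e \<in> E" "v \<in> e" for e
    using that less.prems(1) unfolding simple_graph_def by (metis insertE insert_commute singletonD)
  have "card (E - F) \<le> 1"
  proof (rule ccontr)
    assume "\<not> card (E - F) \<le> 1"
    then obtain a b where ab: "a \<in> E - F" "b \<in> E - F" "a \<noteq> b"
      using finE by (metis One_nat_def card_le_Suc0_iff_eq finite_Diff)
    then obtain w w' where "a = {v, w}" "b = {v, w'}" using inc by (metis (no_types, lifting) DiffE F_def mem_Collect_eq)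
    then show False using ab leaf by (metis DiffD1)
  qed
  moreover have "card E = card F + card (E - F)"
    using finE card_Un_disjoint[of F "E - F"]
    by (auto simp: F_def Un_absorb1)
  \<comment> \<open>The second disjunct covers \<open>V = {v}\<close>, where the induction
    hypothesis would meet an empty vertex set; edges have two distinct ends, so there are
    none.\<close>
  moreover have "card F < card V - 1 \<or> (E = {} \<and> F = {})"
  proof (cases "V = {v}")
    case True
    then show ?thesis using less.prems(1) by (auto simp: simple_graph_def F_def)
  next
    case False
    have "simple_graph (V - {v}) F"
      using less.prems(1) unfolding simple_graph_def F_def by fastforce
    moreover have "\<nexists>p. graph_cycle F p"
      using less.prems(3) by (auto simp: graph_cycle_def F_def)
    moreover have "card (V - {v}) < card V" using fin v by (rule card_Diff1_less)
    ultimately show ?thesis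
      using less.hyps[of "V - {v}" F] False v fin less.prems(2) by auto
  qed
  moreover have "card V > 0" using fin v card_gt_0_iff by blast
  ultimately show ?case by auto
qed

section \<open>Edges carrying an acyclic flow\<close>

lemma ends_eq:
  assumes "e = {x, y}"
  shows "e = {fst (ends e), snd (ends e)}"
  using someI[of "\<lambda>p. case p of (x, y) \<Rightarrow> e = {x, y}" "(x, y)"] assms
  unfolding ends_def by (auto split: prod.splits)

lemma ends_in_arcs:
  assumes "simple_graph V E" "e \<in> E"
  shows "ends e \<in> arcs V E" "e = {fst (ends e), snd (ends e)}"
proof -
  obtain x y where xy: "x \<in> V" "y \<in> V" "e = {x, y}"
    using assms by (auto simp: simple_graph_def)
  show e: "e = {fst (ends e), snd (ends e)}" using ends_eq xy by metis
  then show "ends e \<in> arcs V E"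
    using xy assms(2) unfolding arcs_def
    by (metis (mono_tags, lifting) SigmaI case_prodI doubleton_eq_iff mem_Collect_eq prod.collapse)
qed

text \<open>Counts the nonzero terms of the edge sums, which read the flow through
  \<open>ends\<close>. These edges belong to \<open>support V E f\<close>, which is a
  forest.\<close>

lemma acyclic_flow_support_card:
  assumes G: "simple_graph V E" and ne: "V \<noteq> {}" and f: "acyclic_flow V E d f"
  shows "card {e \<in> E. f (ends e) \<noteq> 0} < card V"
proof -
  have sub: "support V E f \<subseteq> E" by (auto simp: support_def arcs_def)
  then have S: "simple_graph V (support V E f)"
    using G by (auto simp: simple_graph_def)
  have "{e \<in> E. f (ends e) \<noteq> 0} \<subseteq> support V E f"
  proof
    fix e assume "e \<in> {e \<in> E. f (ends e) \<noteq> 0}"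
    then show "e \<in> support V E f"
      using ends_in_arcs[OF G, of e] unfolding support_def
      by (metis (mono_tags, lifting) mem_Collect_eq prod.collapse)
  qed
  then have "card {e \<in> E. f (ends e) \<noteq> 0} \<le> card (support V E f)"
    using simple_graph_finite_edges[OF S] by (rule card_mono[rotated])
  also have "\<dots> < card V"
    using forest_card_edges[OF S ne] f by (simp add: acyclic_flow_def)
  finally show ?thesis .
qed

section \<open>Power loss against Transshipment cost\<close>

lemma sum_power2_le_power2_sum:
  fixes a :: "'b \<Rightarrow> real"
  assumes "finite A" "\<And>x. x \<in> A \<Longrightarrow> 0 \<le> a x"
  shows "(\<Sum>x\<in>A. (a x)\<^sup>2) \<le> (\<Sum>x\<in>A. a x)\<^sup>2"
  using assms
proof (induction A rule: finite_induct)
  case (insert x A)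
  then have "0 \<le> a x * sum a A" by (simp add: sum_nonneg)
  moreover have "(\<Sum>x\<in>A. (a x)\<^sup>2) \<le> (\<Sum>x\<in>A. a x)\<^sup>2" using insert by auto
  ultimately show ?case using insert.hyps by (simp add: power2_sum)
qed simp

lemma power_loss_le_transport_cost_power2:
  assumes "finite E" "\<And>e. e \<in> E \<Longrightarrow> 0 \<le> r e"
  shows "power_loss E r f \<le> (transport_cost E (\<lambda>e. sqrt (r e)) f)\<^sup>2"
proof -
  have "power_loss E r f = (\<Sum>e\<in>E. (sqrt (r e) * \<bar>f (ends e)\<bar>)\<^sup>2)"
    unfolding power_loss_def using assms by (intro sum.cong) (auto simp: power_mult_distrib)
  also have "\<dots> \<le> (\<Sum>e\<in>E. sqrt (r e) * \<bar>f (ends e)\<bar>)\<^sup>2"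
    using assms by (intro sum_power2_le_power2_sum) auto
  finally show ?thesis by (simp add: transport_cost_def)
qed

text \<open>Cauchy-Schwarz is applied only to the edges carrying flow, so the factor is their number
  instead of \<open>card E\<close>.\<close>

lemma transport_cost_power2_le_power_loss:
  assumes "finite E" "\<And>e. e \<in> E \<Longrightarrow> 0 \<le> r e"
  shows "(transport_cost E (\<lambda>e. sqrt (r e)) f)\<^sup>2
    \<le> real (card {e \<in> E. f (ends e) \<noteq> 0}) * power_loss E r f"
proof -
  let ?S = "{e \<in> E. f (ends e) \<noteq> 0}"
  have "transport_cost E (\<lambda>e. sqrt (r e)) f = (\<Sum>e\<in>?S. sqrt (r e) * \<bar>f (ends e)\<bar>)"
    unfolding transport_cost_def using assms(1) by (intro sum.mono_neutral_right) auto
  then have "(transport_cost E (\<lambda>e. sqrt (r e)) f)\<^sup>2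
      \<le> (\<Sum>e\<in>?S. (sqrt (r e) * \<bar>f (ends e)\<bar>)\<^sup>2) * card ?S"
    using assms(1) by (simp add: sum_squared_le_sum_of_squares)
  also have "(\<Sum>e\<in>?S. (sqrt (r e) * \<bar>f (ends e)\<bar>)\<^sup>2) = (\<Sum>e\<in>?S. r e * (f (ends e))\<^sup>2)"
    using assms(2) by (intro sum.cong) (auto simp: power_mult_distrib)
  also have "\<dots> = power_loss E r f"
    unfolding power_loss_def using assms(1) by (intro sum.mono_neutral_left) auto
  finally show ?thesis by (simp add: mult.commute)
qed

lemma power_loss_approximation:
  assumes N: "network V E d r"
    and f: "acyclic_flow V E d f" "optimal_transshipment V E d (\<lambda>e. sqrt (r e)) f"
  shows "power_loss E r f \<le> (real (card V) - 1) * OPT V E d r"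
proof -
  have G: "simple_graph V E" and ne: "V \<noteq> {}" and r: "\<And>e. e \<in> E \<Longrightarrow> 0 \<le> r e"
    using N by (auto simp: network_def connected_graph_def)
  have fin: "finite V" "finite E"
    using G simple_graph_finite_edges by (auto simp: simple_graph_def)
  define k where "k = real (card V) - 1"
  have loss_nonneg: "0 \<le> power_loss E r g" for g
    unfolding power_loss_def using r by (intro sum_nonneg) auto
  \<comment> \<open>The competitor \<open>g\<close> is arbitrary here; the infimum in
    \<open>OPT\<close> is taken only afterwards.\<close>
  have bound: "power_loss E r f \<le> k * power_loss E r g" if g: "acyclic_flow V E d g" for g
  proof -
    let ?c = "transport_cost E (\<lambda>e. sqrt (r e))"
    have "0 \<le> ?c f" unfolding transport_cost_def using r by (intro sum_nonneg) auto
    moreover have "?c f \<le> ?c g"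
      using f(2) g by (simp add: optimal_transshipment_def acyclic_flow_def)
    ultimately have "(?c f)\<^sup>2 \<le> (?c g)\<^sup>2" by (intro power_mono)
    moreover have "power_loss E r f \<le> (?c f)\<^sup>2"
      using power_loss_le_transport_cost_power2 fin r by blast
    moreover have "(?c g)\<^sup>2 \<le> real (card {e \<in> E. g (ends e) \<noteq> 0}) * power_loss E r g"
      using transport_cost_power2_le_power_loss fin r by blast
    moreover have "real (card {e \<in> E. g (ends e) \<noteq> 0}) \<le> k"
      using acyclic_flow_support_card[OF G ne g] unfolding k_def by linarith
    then have "real (card {e \<in> E. g (ends e) \<noteq> 0}) * power_loss E r g \<le> k * power_loss E r g"
      using loss_nonneg by (rule mult_right_mono)
    ultimately show ?thesis by linarith
  qed
  have "k \<ge> 0" unfolding k_def using fin ne by (simp add: Suc_leI card_gt_0_iff)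
  \<comment> \<open>The case \<open>k = 0\<close> is separate because the infimum argument divides
    by \<open>k\<close>. There \<open>bound\<close> with \<open>g = f\<close> already gives loss at
    most 0.\<close>
  then consider "k = 0" | "k > 0" by linarith
  then have "power_loss E r f \<le> k * OPT V E d r"
  proof cases
    case 1
    then show ?thesis using bound[OF f(1)] by simp
  next
    case 2
    \<comment> \<open>Divided by \<open>k\<close>, \<open>bound\<close> says that the left side is a
      lower bound of all acyclic losses, hence of their infimum.\<close>
    have "power_loss E r f / k \<le> OPT V E d r"
      unfolding OPT_def
    proof (rule cINF_greatest)
      show "{f. acyclic_flow V E d f} \<noteq> {}" using f(1) by blast
    qed (use bound 2 in \<open>simp add: divide_le_eq mult.commute\<close>)
    then show ?thesis using 2 by (simp add: divide_le_eq mult.commute)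
  qed
  then show ?thesis by (simp add: k_def)
qed

section \<open>The square-root reduction on the real RAM\<close>

text \<open>The state after \<open>j\<close> iterations of the loop: \<open>x\<close> is the last square root computed.\<close>

definition sqrt_loop_state ::
    "nat \<Rightarrow> (nat \<times> nat) list \<Rightarrow> (nat \<Rightarrow> real) \<Rightarrow> (nat set \<Rightarrow> real) \<Rightarrow> nat \<Rightarrow> real \<Rightarrow> state" where
  "sqrt_loop_state n es d w j x =
     \<lparr>nreg = (\<lambda>_. 0)(0 := n, 1 := length es, 2 := 1, 3 := n + j, 4 := n + length es),
      nmem = nmem (encode n es d w),
      rreg = (\<lambda>_. 0)(0 := x),
      rmem = (\<lambda>i. if i < n + j then rmem (encode n es d (\<lambda>e. sqrt (w e))) i
                  else rmem (encode n es d w) i)\<rparr>"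

text \<open>Induction on the number of remaining weights. An iteration costs one test and four
  instructions, and the failing test adds the final 1. The value \<open>x'\<close> left in the real
  register is irrelevant, as it is cleared later.\<close>

lemma exec_sqrt_loop:
  assumes "j \<le> length es"
  shows "\<exists>x'. exec
    (While (NLess 3 4)
       (Do (RLoad 0 3) ;; Do (RSqrt 0 0) ;; Do (RStore 3 0) ;; Do (NAdd 3 3 2)))
    (sqrt_loop_state n es d w j x) (5 * (length es - j) + 1)
    (sqrt_loop_state n es d w (length es) x')"
  using assms
proof (induction "length es - j" arbitrary: j x)
  case 0
  then have "j = length es" by simp
  then have "\<not> holds (NLess 3 4) (sqrt_loop_state n es d w j x)"
    by (simp add: sqrt_loop_state_def)
  then show ?case using exec.WhileFalse \<open>j = length es\<close> by fastforce
next
  case (Suc k)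
  let ?body = "Do (RLoad 0 3) ;; Do (RSqrt 0 0) ;; Do (RStore 3 0) ;; Do (NAdd 3 3 2)"
  let ?s = "sqrt_loop_state n es d w"
  have j: "j < length es" and k: "k = length es - Suc j" using Suc by auto
  obtain x' where IH: "exec (While (NLess 3 4) ?body) (?s (Suc j) (sqrt (w {fst (es ! j), snd (es ! j)})))
      (5 * (length es - Suc j) + 1) (?s (length es) x')"
    using Suc.hyps(1)[OF k] j by fastforce
  \<comment> \<open>Cell \<open>n + j\<close> of the real memory holds the weight of edge
    \<open>j\<close>, so one pass of the body extends the converted prefix by that cell.\<close>
  have step: "?s (Suc j) (sqrt (w {fst (es ! j), snd (es ! j)}))
      = step (NAdd 3 3 2) (step (RStore 3 0) (step (RSqrt 0 0) (step (RLoad 0 3) (?s j x))))"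
    using j by (auto simp: sqrt_loop_state_def encode_def fun_eq_iff)
  \<comment> \<open>The nested sum mirrors the right-associated \<open>;;\<close>, so that the rule
    \<open>exec.Seq\<close> unifies.\<close>
  have "exec ?body (?s j x) (1 + (1 + (1 + 1)))
      (?s (Suc j) (sqrt (w {fst (es ! j), snd (es ! j)})))"
    unfolding step by (rule exec.Seq exec.Do)+
  moreover have "(1 :: nat) + (1 + (1 + 1)) = 4" by simp
  ultimately have "exec ?body (?s j x) 4 (?s (Suc j) (sqrt (w {fst (es ! j), snd (es ! j)})))"
    by metis
  moreover have "holds (NLess 3 4) (?s j x)" using j by (simp add: sqrt_loop_state_def)
  ultimately have "exec (While (NLess 3 4) ?body) (?s j x)
      (Suc (4 + (5 * (length es - Suc j) + 1))) (?s (length es) x')"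
    using IH exec.WhileTrue by blast
  moreover have "Suc (4 + (5 * (length es - Suc j) + 1)) = 5 * (length es - j) + 1"
    using j by simp
  ultimately show ?case by metis
qed

text \<open>The constant 9 is four instructions of setup, four of cleanup and the failing loop test.
  Ending exactly in an encoding is what allows a solver to be run next.\<close>

lemma exec_sqrt_weights:
  "exec sqrt_weights (encode n es d w) (5 * length es + 9) (encode n es d (\<lambda>e. sqrt (w e)))"
proof -
  obtain x where loop: "exec
    (While (NLess 3 4)
       (Do (RLoad 0 3) ;; Do (RSqrt 0 0) ;; Do (RStore 3 0) ;; Do (NAdd 3 3 2)))
    (sqrt_loop_state n es d w 0 0) (5 * length es + 1) (sqrt_loop_state n es d w (length es) x)"
    using exec_sqrt_loop[of 0 es n d w 0] by auto
  have init: "sqrt_loop_state n es d w 0 0 = step (NAdd 4 0 1) (step (NAdd 3 0 3)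
      (step (NConst 3 0) (step (NConst 2 1) (encode n es d w))))"
    by (auto simp: sqrt_loop_state_def encode_def fun_eq_iff)
  have final: "encode n es d (\<lambda>e. sqrt (w e)) = step (RConst 0 0) (step (NConst 4 0)
      (step (NConst 3 0) (step (NConst 2 0) (sqrt_loop_state n es d w (length es) x))))"
    by (auto simp: sqrt_loop_state_def encode_def fun_eq_iff)
  have "exec sqrt_weights (encode n es d w)
      (1 + (1 + (1 + (1 + ((5 * length es + 1) + (1 + (1 + (1 + 1))))))))
      (encode n es d (\<lambda>e. sqrt (w e)))"
    unfolding sqrt_weights_def final by (rule exec.Seq exec.Do loop[unfolded init])+
  moreover have "1 + (1 + (1 + (1 + ((5 * length es + 1) + (1 + (1 + (1 + 1)))))))
      = 5 * length es + 9"
    by simp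
  ultimately show ?thesis by metis
qed

lemma dnr_algorithm_correct:
  assumes "acyclic_transshipment_solver P"
  shows "dnr_approximation_algorithm (\<lambda>n. real n - 1) (dnr_algorithm P)"
proof -
  obtain p :: "nat poly" where p: "\<And>n es d w. edge_listing es \<Longrightarrow> network {..<n} (edges_of es) d w \<Longrightarrow>
      \<exists>t s f. exec P (encode n es d w) t s \<and> t \<le> poly p (n + length es) \<and> output_flow n es s f \<and>
        acyclic_flow {..<n} (edges_of es) d f \<and> optimal_transshipment {..<n} (edges_of es) d w f"
    using assms unfolding acyclic_transshipment_solver_def poly_time_computes_def by blast
  show ?thesis
    unfolding dnr_approximation_algorithm_def poly_time_computes_def
  \<comment> \<open>\<open>[:9, 5:]\<close> is \<open>9 + 5 * X\<close>; at
    \<open>n + length es\<close> it dominates the preprocessing time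
    \<open>5 * length es + 9\<close>.\<close>
  proof (intro exI[of _ "[:9, 5:] + p"] allI impI)
    fix n es d r
    assume L: "edge_listing es" and N: "network {..<n} (edges_of es) d r"
    \<comment> \<open>Square roots of nonnegative resistances are nonnegative, so they are
      admissible costs for the solver.\<close>
    then have "network {..<n} (edges_of es) d (\<lambda>e. sqrt (r e))" by (simp add: network_def)
    from p[OF L this] obtain t s f where
      run: "exec P (encode n es d (\<lambda>e. sqrt (r e))) t s" and t: "t \<le> poly p (n + length es)"
      and out: "output_flow n es s f" and f: "acyclic_flow {..<n} (edges_of es) d f"
        "optimal_transshipment {..<n} (edges_of es) d (\<lambda>e. sqrt (r e)) f"
      by blast
    have "exec (dnr_algorithm P) (encode n es d r) (5 * length es + 9 + t) s"
      unfolding dnr_algorithm_def using exec_sqrt_weights run by (rule exec.Seq)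
    moreover have "5 * length es + 9 + t \<le> poly ([:9, 5:] + p) (n + length es)"
      using t by simp
    ultimately show "\<exists>t s f. exec (dnr_algorithm P) (encode n es d r) t s \<and>
        t \<le> poly ([:9, 5:] + p) (n + length es) \<and> output_flow n es s f \<and>
        acyclic_flow {..<n} (edges_of es) d f \<and>
        power_loss (edges_of es) r f
          \<le> (real (card {..<n}) - 1) * OPT {..<n} (edges_of es) d r"
      using out f power_loss_approximation[OF N f] by blast
  qed
qed

text \<open>The approximation guarantee holds over any vertex type, while running time refers to
  encoded networks on natural numbers. Polynomial-time solvability of Transshipment enters as the
  hypothesis on \<open>P\<close>, which is used as a subroutine.\<close>

theorem theorem4:
  "(\<forall>(V :: 'a set) E d r f.
      network V E d r \<longrightarrow>
      acyclic_flow V E d f \<and> optimal_transshipment V E d (\<lambda>e. sqrt (r e)) f \<longrightarrow>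
      power_loss E r f \<le> (real (card V) - 1) * OPT V E d r) \<and>
   (\<forall>P. acyclic_transshipment_solver P \<longrightarrow>
      dnr_approximation_algorithm (\<lambda>n. real n - 1) (dnr_algorithm P))"
  using power_loss_approximation dnr_algorithm_correct by blast

end
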